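(* Let $x\in D_1$ and $\nu,\mu\in\mathbb{C}$ with $\nu+\mu\notin-\mathbb{N}$. Put $u=x+i\sqrt{1-x^2}$ and $v=x-i\sqrt{1-x^2}=\frac1u$. Then $$\mathsf{Q}_\nu^\mu(x)=\sqrt{\pi}\,2^{\mu-1}(1-x^2)^{\frac12\mu}\frac{\Gamma(\nu+\mu+1)}{\Gamma(\nu+\frac32)}\Bigg[u^{\nu+\mu+1}{}_2F_1\!\left(\mu+\tfrac12,\nu+\mu+1;\nu+\tfrac32;\frac{u}{v}\right)+v^{\nu+\mu+1}{}_2F_1\!\left(\mu+\tfrac12,\nu+\mu+1;\nu+\tfrac32;\frac{v}{u}\right)\Bigg].$$
   Context: $\mathbb{N}=\{1,2,3,\dots\}$, $-\mathbb{N}=\{-1,-2,\dots\}$. $D_1=\mathbb{C}\setminus((-\infty,-1]\cup[1,\infty))$, $D_2=\mathbb{C}\setminus(-\infty,1]$. Complex powers and roots are principal values. ${}_2F_1(a,b;c;w)$ is the Gauss hypergeometric function, principal branch on $\mathbb{C}\setminus[1,\infty)$ (the analytic continuation of $\sum_{n\ge0}\frac{(a)_n(b)_n}{(c)_n}\frac{w^n}{n!}$). A quotient ${}_2F_1(a,b;c;w)/\Gamma(c)$ with $c\in\{0,-1,-2,\dots\}$ is read as Olver's regularized function, the analytic continuation of $\sum_{n\ge0}\frac{(a)_n(b)_n}{\Gamma(c+n)}\frac{w^n}{n!}$. Associated Legendre function of the second kind: for $z\in D_2$, $\nu+\mu\in\mathbb{C}\setminus-\mathbb{N}$, $$Q_\nu^\mu(z)=\frac{\sqrt{\pi}\,e^{i\pi\mu}\Gamma(\nu+\mu+1)(z^2-1)^{\frac12\mu}}{2^{\nu+1}\Gamma(\nu+\frac32)z^{\nu+\mu+1}}\,{}_2F_1\!\left(\tfrac{\nu+\mu+2}{2},\tfrac{\nu+\mu+1}{2};\nu+\tfrac32;\tfrac1{z^2}\right),$$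 where $(z^2-1)^\alpha:=(z+1)^\alpha(z-1)^\alpha$. Ferrers function of the second kind: for $x\in(-1,1)$, $$\mathsf{Q}_\nu^\mu(x)=\tfrac12\big[e^{-\frac12 i\pi\mu}\,e^{-i\pi\mu}Q_\nu^\mu(x+i0)+e^{\frac12 i\pi\mu}\,e^{-i\pi\mu}Q_\nu^\mu(x-i0)\big],$$ where $x\pm i0$ denotes the limit from the upper/lower half-plane, and $\mathsf{Q}_\nu^\mu$ is extended analytically to $D_1$. *)

theory Defs
  imports "HOL-Complex_Analysis.Complex_Analysis"
begin

definition D1 :: "complex set" where
  "D1 = - complex_of_real ` ({..-1} \<union> {1..})"

definition neg_nats :: "complex set" where
  "neg_nats = {- of_nat n | n. n \<ge> 1}"

text \<open>The analytic continuation to \<open>S\<close> of a function \<open>f\<close> whose values are prescribed on \<open>A\<close>.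
  It is only meaningful for \<open>z \<in> S\<close>, and it is unique if \<open>S\<close> is open and
  connected and \<open>A\<close> accumulates at some point of \<open>S\<close>; see the lemma below.\<close>

definition analytic_extension ::
    "(complex \<Rightarrow> complex) \<Rightarrow> complex set \<Rightarrow> complex set \<Rightarrow> complex \<Rightarrow> complex" where
  "analytic_extension f A S z =
     (THE y. \<exists>F. F holomorphic_on S \<and> (\<forall>w\<in>A. F w = f w) \<and> y = F z)"

lemma analytic_extension_eqI:
  assumes "open S" "connected S" "A \<subseteq> S" "\<xi> \<in> S" "\<xi> islimpt A"
    and F: "F holomorphic_on S" "\<And>w. w \<in> A \<Longrightarrow> F w = f w" and z: "z \<in> S"
  shows "analytic_extension f A S z = F z"
  unfolding analytic_extension_def
proof (rule the_equality)
  show "\<exists>G. G holomorphic_on S \<and> (\<forall>w\<in>A. G w = f w) \<and> F z = G z"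
    using F by blast
next
  fix y assume "\<exists>G. G holomorphic_on S \<and> (\<forall>w\<in>A. G w = f w) \<and> y = G z"
  then obtain G where G: "G holomorphic_on S" "\<forall>w\<in>A. G w = f w" "y = G z" by blast
  have "(\<lambda>w. G w - F w) holomorphic_on S"
    by (intro holomorphic_intros G F)
  then have "G z - F z = 0"
    by (rule analytic_continuation[where U = A and \<xi> = \<xi>]) (use assms G in auto)
  then show "y = F z" using G by simp
qed

text \<open>Both continuations below are to the plane cut along \<open>[1, \<infinity>)\<close>.
  The first one is meaningful only if \<open>c\<close> is not a nonpositive integer.\<close>

definition hyp2F1 :: "complex \<Rightarrow> complex \<Rightarrow> complex \<Rightarrow> complex \<Rightarrow> complex" where
  "hyp2F1 a b c =
     analytic_extension
       (\<lambda>w. \<Sum>n. pochhammer a n * pochhammer b n / pochhammer c n * w ^ n / fact n)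
       (ball 0 1) (- complex_of_real ` {1..})"

definition hyp2F1_reg :: "complex \<Rightarrow> complex \<Rightarrow> complex \<Rightarrow> complex \<Rightarrow> complex" where
  "hyp2F1_reg a b c =
     analytic_extension
       (\<lambda>w. \<Sum>n. pochhammer a n * pochhammer b n * rGamma (c + of_nat n) * w ^ n / fact n)
       (ball 0 1) (- complex_of_real ` {1..})"

text \<open>The quotient \<open>\<^sub>2F\<^sub>1(a,b;c;w) / \<Gamma>(c)\<close>, read as Olver's regularized function when
  \<open>c\<close> is a nonpositive integer.\<close>

definition hyp2F1_over_Gamma :: "complex \<Rightarrow> complex \<Rightarrow> complex \<Rightarrow> complex \<Rightarrow> complex" where
  "hyp2F1_over_Gamma a b c w =
     (if c \<in> \<int>\<^sub>\<le>\<^sub>0 then hyp2F1_reg a b c w else hyp2F1 a b c w / Gamma c)"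

text \<open>The associated Legendre function of the second kind, meaningful for
  \<open>z \<notin> (-\<infinity>, 1]\<close> and \<open>\<nu> + \<mu> \<notin> neg_nats\<close>. The factor \<open>1 / \<Gamma>(\<nu> + 3/2)\<close>
  is part of \<open>hyp2F1_over_Gamma\<close>, and \<open>(z\<^sup>2 - 1)\<^sup>\<alpha>\<close> stands for
  \<open>(z + 1)\<^sup>\<alpha> (z - 1)\<^sup>\<alpha>\<close>.\<close>

definition legendre_Q :: "complex \<Rightarrow> complex \<Rightarrow> complex \<Rightarrow> complex" where
  "legendre_Q \<nu> \<mu> z =
     of_real (sqrt pi) * exp (\<i> * of_real pi * \<mu>) * Gamma (\<nu> + \<mu> + 1)
       * ((z + 1) powr (\<mu> / 2) * (z - 1) powr (\<mu> / 2))
       / (2 powr (\<nu> + 1) * z powr (\<nu> + \<mu> + 1))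
       * hyp2F1_over_Gamma ((\<nu> + \<mu> + 2) / 2) ((\<nu> + \<mu> + 1) / 2) (\<nu> + 3 / 2) (1 / z\<^sup>2)"

text \<open>The Ferrers function of the second kind on the interval \<open>(-1, 1)\<close>, given by the
  limits of \<open>legendre_Q\<close> from the upper and the lower half-plane.\<close>

definition ferrers_Q_interval :: "complex \<Rightarrow> complex \<Rightarrow> complex \<Rightarrow> complex" where
  "ferrers_Q_interval \<nu> \<mu> x =
     1 / 2 *
       (exp (- \<i> * of_real pi * \<mu> / 2) * exp (- \<i> * of_real pi * \<mu>)
          * Lim (at x within {z. Im z > 0}) (legendre_Q \<nu> \<mu>)
      + exp (\<i> * of_real pi * \<mu> / 2) * exp (- \<i> * of_real pi * \<mu>)
          * Lim (at x within {z. Im z < 0}) (legendre_Q \<nu> \<mu>))"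

definition ferrers_Q :: "complex \<Rightarrow> complex \<Rightarrow> complex \<Rightarrow> complex" where
  "ferrers_Q \<nu> \<mu> =
     analytic_extension (ferrers_Q_interval \<nu> \<mu>) (complex_of_real ` {-1<..<1}) D1"

end

theory Submission
  imports Defs
begin

text \<open>For \<open>Im z \<noteq> 0\<close> let \<open>w\<close> be the root of \<open>w + 1/w = 2 z\<close> with \<open>\<bar>w\<bar> < 1\<close>. The quadratic transformation
  \<open>F((a+1)/2, a/2; c; 4 t/(1+t)\<^sup>2) = (1+t)\<^sup>a F(b, a; c; t)\<close>, \<open>c = a - b + 1\<close>, at \<open>t = w\<^sup>2\<close> rewrites
  \<open>Q\<close> as a function of \<open>w\<close>. On the upper and the lower half-plane, \<open>w = z \<mp> \<i> \<surd>(1 - z\<^sup>2)\<close>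
  respectively; both expressions are holomorphic on all of \<open>D1\<close>, where \<open>w\<^sup>2\<close> avoids \<open>[1, \<infinity>)\<close>. Hence the
  two boundary values exist and their average, which is the Ferrers function, continues to \<open>D1\<close>.\<close>

section \<open>Analytic continuation of the hypergeometric series\<close>

text \<open>For any \<open>R > 1\<close>, strong induction gives
  \<open>norm (g n) \<le> M * R ^ n\<close>: the geometric sum costs at most a factor
  \<open>\<bar>C\<bar> / (R - 1)\<close>, and \<open>norm (of_nat n + d)\<close> eventually exceeds
  it. As \<open>R\<close> may be arbitrarily close to 1, the radius is at least 1.\<close>

lemma conv_radius_ge_1_if_bounded_by_partial_sums:
  fixes g :: "nat \<Rightarrow> complex" and d :: complex and C :: real
  assumes rec: "\<And>n. n \<ge> 1 \<Longrightarrow> norm (of_nat n + d) * norm (g n) \<le> C * (\<Sum>k<n. norm (g k))"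
  shows "conv_radius g \<ge> 1"
proof (rule conv_radius_geI_ex')
  fix r :: real assume r: "0 < r" "ereal r < 1"
  then obtain s where s: "r < s" "s < 1" using dense[of r 1] by auto
  define R where "R = 1 / s"
  have R: "R > 1" using s r by (simp add: R_def)
  \<comment> \<open>From \<open>N\<close> on, \<open>norm (of_nat n + d)\<close> dominates the
    geometric factor; the extra 1 keeps it positive, so that it can be cancelled. The constant
    \<open>M\<close> takes care of the initial terms.\<close>
  obtain N :: nat where N: "real N \<ge> norm d + \<bar>C\<bar> / (R - 1) + 1"
    using real_arch_simple by blast
  define M where "M = (\<Sum>k\<le>N. norm (g k))"
  have M: "M \<ge> 0" by (auto simp: M_def sum_nonneg)
  have bound: "norm (g n) \<le> M * R ^ n" for n
  proof (induction n rule: less_induct)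
    case (less n)
    show ?case
    proof (cases "n \<le> N")
      case True
      have "norm (g n) \<le> M"
        unfolding M_def by (rule member_le_sum) (use True in auto)
      also have "\<dots> \<le> M * R ^ n"
        using M R by (simp add: mult_le_cancel_left1 one_le_power)
      finally show ?thesis .
    next
      case False
      have "real n - norm d \<le> norm (of_nat n + d)"
        using norm_triangle_ineq2[of "of_nat n" "- d"] by simp
      moreover have "real n \<ge> real N" using False by simp
      ultimately have n: "norm (of_nat n + d) \<ge> \<bar>C\<bar> / (R - 1) + 1"
        using N by linarith
      have pos: "norm (of_nat n + d) > 0"
        using n R by (smt (verit) divide_nonneg_pos abs_ge_zero)
      have "norm (of_nat n + d) * norm (g n) \<le> C * (\<Sum>k<n. norm (g k))"
        using rec False by simp
      also have "\<dots> \<le> \<bar>C\<bar> * (\<Sum>k<n. norm (g k))"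
        by (intro mult_right_mono sum_nonneg) auto
      also have "\<dots> \<le> \<bar>C\<bar> * (\<Sum>k<n. M * R ^ k)"
        by (intro mult_left_mono sum_mono less) auto
      also have "\<dots> = \<bar>C\<bar> * M * ((R ^ n - 1) / (R - 1))"
        using R by (simp add: geometric_sum flip: sum_distrib_left)
      also have "\<dots> \<le> \<bar>C\<bar> * M * (R ^ n / (R - 1))"
        using R M by (intro mult_left_mono divide_right_mono) auto
      also have "\<dots> = (\<bar>C\<bar> / (R - 1)) * (M * R ^ n)" by simp
      also have "\<dots> \<le> norm (of_nat n + d) * (M * R ^ n)"
        using n M R by (intro mult_right_mono) auto
      finally show ?thesis using pos by simp
    qed
  qed
  show "summable (\<lambda>n. g n * of_real r ^ n)"
  proof (rule summable_comparison_test')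
    show "summable (\<lambda>n. M * (r / s) ^ n)"
      using r s by (intro summable_mult summable_geometric) auto
    show "norm (g n * of_real r ^ n) \<le> M * (r / s) ^ n" if "n \<ge> 0" for n
    proof -
      have "norm (g n * of_real r ^ n) = norm (g n) * r ^ n"
        using r by (simp add: norm_mult norm_power)
      also have "\<dots> \<le> M * R ^ n * r ^ n"
        using bound r by (intro mult_right_mono) auto
      finally show ?thesis by (simp add: R_def power_divide)
    qed
  qed
qed

section \<open>The hypergeometric series and its differential equation\<close>

text \<open>The factor \<open>rGamma\<close> is entire in \<open>c\<close>, so nonpositive integers
  \<open>c\<close> need no separate treatment.\<close>

definition hyp_coeff :: "complex \<Rightarrow> complex \<Rightarrow> complex \<Rightarrow> nat \<Rightarrow> complex" where
  "hyp_coeff a b c n = pochhammer a n * pochhammer b n * rGamma (c + of_nat n) / fact n"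

definition hyp_fps :: "complex \<Rightarrow> complex \<Rightarrow> complex \<Rightarrow> complex fps" where
  "hyp_fps a b c = Abs_fps (hyp_coeff a b c)"

text \<open>This is \<open>rGamma z = z * rGamma (z + 1)\<close> at \<open>z = c + n\<close>. The
  recurrence is left undivided because \<open>of_nat n + c\<close> may vanish.\<close>

lemma hyp_coeff_Suc:
  "of_nat (Suc n) * (of_nat n + c) * hyp_coeff a b c (Suc n)
     = (of_nat n + a) * (of_nat n + b) * hyp_coeff a b c n"
proof -
  have "rGamma (c + of_nat n) = (c + of_nat n) * rGamma (c + of_nat (Suc n))"
    using rGamma_plus1[of "c + of_nat n"] by (simp add: add_ac)
  then show ?thesis
    unfolding hyp_coeff_def by (simp add: pochhammer_rec' field_simps del: of_nat_Suc)
qed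

text \<open>The ratio of consecutive coefficients tends to 1, hence is eventually below 2, and the
  ratio test applies at \<open>1/3\<close>. A positive radius is enough to have a germ at 0;
  convergence on the unit disc follows later from the continuation.\<close>

lemma conv_radius_hyp_pos: "fps_conv_radius (hyp_fps a b c) > 0"
proof -
  define q where "q n = ((of_nat n + a) * (of_nat n + b)) / (of_nat (Suc n) * (of_nat n + c))" for n :: nat
  have inv: "(\<lambda>n. inverse (of_nat n :: complex)) \<longlonglongrightarrow> 0"
    by (rule lim_inverse_n)
  have "(\<lambda>n. ((1 + a * inverse (of_nat n)) * (1 + b * inverse (of_nat n)))
      / ((1 + inverse (of_nat n)) * (1 + c * inverse (of_nat n)))) \<longlonglongrightarrow>
      ((1 + a * 0) * (1 + b * 0)) / ((1 + 0) * (1 + c * 0))"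
    by (intro tendsto_intros inv) auto
  moreover have "eventually (\<lambda>n. ((1 + a * inverse (of_nat n)) * (1 + b * inverse (of_nat n)))
      / ((1 + inverse (of_nat n)) * (1 + c * inverse (of_nat n))) = q n) sequentially"
    using eventually_gt_at_top[of 0]
  proof eventually_elim
    case (elim n)
    then have "(1 + a * inverse (of_nat n)) * (1 + b * inverse (of_nat n)) =
        (of_nat n + a) * (of_nat n + b) / of_nat n ^ 2"
      and "(1 + inverse (of_nat n)) * (1 + c * inverse (of_nat n)) =
        of_nat (Suc n) * (of_nat n + c) / of_nat n ^ 2"
      by (simp_all add: field_simps power2_eq_square)
    then show ?case using elim by (simp add: q_def)
  qed
  ultimately have "q \<longlonglongrightarrow> 1"
    by (simp add: tendsto_cong)
  then have "(\<lambda>n. norm (q n)) \<longlonglongrightarrow> norm (1::complex)" by (rule tendsto_norm)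
  then have ev: "eventually (\<lambda>n. norm (q n) < 2) sequentially"
    by (rule order_tendstoD) auto
  \<comment> \<open>Beyond \<open>norm c\<close> the factor \<open>of_nat n + c\<close> is nonzero,
    so the recurrence may be divided by it.\<close>
  obtain N0 :: nat where N0: "real N0 > norm c" using reals_Archimedean2 by blast
  from ev obtain N where N: "\<And>n. n \<ge> N \<Longrightarrow> norm (q n) < 2" "N \<ge> N0"
    unfolding eventually_sequentially by (metis le_trans nle_le)
  have "summable (\<lambda>n. hyp_coeff a b c n * (1/3) ^ n)"
  proof (rule summable_ratio_test[of "2/3"])
    fix n assume n: "n \<ge> N"
    have "of_nat n + c \<noteq> 0"
    proof
      assume "of_nat n + c = 0"
      then have "norm c = real n" by (metis add_eq_0_iff norm_minus_cancel norm_of_nat)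
      then show False using N0 N n by linarith
    qed
    then have "hyp_coeff a b c (Suc n) = q n * hyp_coeff a b c n"
      using hyp_coeff_Suc[of n c a b]
      by (simp add: q_def eq_divide_eq mult_ac del: of_nat_Suc)
    then have "norm (hyp_coeff a b c (Suc n) * (1/3) ^ Suc n)
        = norm (q n) / 3 * norm (hyp_coeff a b c n * (1/3) ^ n)"
      by (simp add: norm_mult norm_power norm_divide)
    also have "\<dots> \<le> 2 / 3 * norm (hyp_coeff a b c n * (1/3) ^ n)"
      using N(1)[OF n] by (intro mult_right_mono) auto
    finally show "norm (hyp_coeff a b c (Suc n) * (1/3) ^ Suc n)
       \<le> 2 / 3 * norm (hyp_coeff a b c n * (1/3) ^ n)" .
  qed auto
  then have "conv_radius (hyp_coeff a b c) \<ge> norm (1/3 :: complex)" by (rule conv_radius_geI)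
  then show ?thesis
    unfolding hyp_fps_def fps_conv_radius_def by (auto simp: norm_divide intro: less_le_trans[rotated])
qed

text \<open>The coefficient of \<open>X^n\<close> in Gauss's equation is exactly the recurrence
  \<open>hyp_coeff_Suc\<close>.\<close>

lemma hyp_fps_ODE:
  fixes a b c :: complex
  defines "A \<equiv> hyp_fps a b c"
  shows "fps_X * (1 - fps_X) * fps_deriv (fps_deriv A)
     + (fps_const c - fps_const (a + b + 1) * fps_X) * fps_deriv A = fps_const (a * b) * A"
proof (rule fps_ext)
  fix n
  show "(fps_X * (1 - fps_X) * fps_deriv (fps_deriv A)
     + (fps_const c - fps_const (a + b + 1) * fps_X) * fps_deriv A) $ n = (fps_const (a * b) * A) $ n"
    using hyp_coeff_Suc[of n c a b]
    by (cases n) (simp_all add: A_def hyp_fps_def algebra_simps)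
qed

text \<open>The map \<open>t \<mapsto> 4 t / (1 + t)\<^sup>2\<close> sends the unit disc conformally onto the slit plane.
  Pulled back along it, the hypergeometric equation has 0 as its only singularity in the disc,
  so a series solution converges in the whole disc.\<close>

lemma koebe_pullback_ODE:
  fixes A :: "complex fps" and a b c :: complex
  defines "J \<equiv> inverse (1 + fps_X)" and "L \<equiv> inverse (1 - fps_X)"
  defines "K \<equiv> 4 * fps_X * J\<^sup>2"
  assumes ODE: "fps_X * (1 - fps_X) * fps_deriv (fps_deriv A)
     + (fps_const c - fps_const (a + b + 1) * fps_X) * fps_deriv A = fps_const (a * b) * A"
  defines "G \<equiv> A oo K"
  shows "fps_X * fps_deriv (fps_X * fps_deriv G) + fps_const (c - 1) * (fps_X * fps_deriv G)
    = - ((fps_const (c - 2 * (a + b)) * fps_X + fps_const (c - 1) * fps_X\<^sup>2) * (L + J)) * (fps_X * fps_deriv G)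
      + fps_const (4 * a * b) * fps_X * J\<^sup>2 * G"
proof -
  let ?X = "fps_X :: complex fps"
  have J: "J * (1 + ?X) = 1" and L: "L * (1 - ?X) = 1"
    unfolding J_def L_def by (auto intro: inverse_mult_eq_1)
  have J': "fps_deriv J = - J\<^sup>2"
    unfolding J_def by (subst fps_inverse_deriv) (auto simp: field_simps)
  have K0: "K $ 0 = 0" by (simp add: K_def)
  have "fps_deriv K = 4 * J\<^sup>2 - 8 * ?X * J ^ 3"
    by (simp add: K_def J' power2_eq_square power3_eq_cube algebra_simps)
  also have "\<dots> = 4 * (1 - ?X) * J ^ 3"
    using J by algebra
  finally have K': "fps_deriv K = 4 * (1 - ?X) * J ^ 3" .
  have "fps_deriv (fps_deriv K) = - 4 * J ^ 3 - 12 * (1 - ?X) * J ^ 4"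
    by (simp add: K' J' power2_eq_square power3_eq_cube power4_eq_xxxx algebra_simps)
  also have "\<dots> = - 8 * (2 - ?X) * J ^ 4"
    using J by algebra
  finally have K'': "fps_deriv (fps_deriv K) = - 8 * (2 - ?X) * J ^ 4" .
  define A1 A2 where "A1 = fps_deriv A oo K" and "A2 = fps_deriv (fps_deriv A) oo K"
  have G': "fps_deriv G = A1 * fps_deriv K"
    unfolding G_def A1_def by (rule fps_compose_deriv[OF K0])
  have A1': "fps_deriv A1 = A2 * fps_deriv K"
    unfolding A1_def A2_def by (rule fps_compose_deriv[OF K0])
  have G'': "fps_deriv (fps_deriv G) = A2 * (fps_deriv K)\<^sup>2 + A1 * fps_deriv (fps_deriv K)"
    by (simp add: G' A1' power2_eq_square algebra_simps)
  have "(?X * (1 - ?X) * fps_deriv (fps_deriv A)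
     + (fps_const c - fps_const (a + b + 1) * ?X) * fps_deriv A) oo K = (fps_const (a * b) * A) oo K"
    using ODE by simp
  then have ODE': "K * (1 - K) * A2 + (fps_const c - fps_const (a + b + 1) * K) * A1 = fps_const (a * b) * G"
    by (simp add: fps_compose_add_distrib fps_compose_sub_distrib fps_compose_mult_distrib[OF K0]
        A1_def A2_def G_def K0)
  have ks: "fps_const (c - 1) = fps_const c - 1" "fps_const (a + b + 1) = fps_const (a + b) + 1"
    "fps_const (c - 2 * (a + b)) = fps_const c - 2 * fps_const (a + b)"
    "fps_const (4 * a * b) = 4 * fps_const (a * b)"
    by (simp_all add: numeral_fps_const flip: fps_const_1_eq_1)
  have d: "fps_deriv (?X * fps_deriv G) = fps_deriv G + ?X * fps_deriv (fps_deriv G)"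
    by simp
  \<comment> \<open>With the constants as indeterminates, what remains is a ring identity modulo
    \<open>J * (1 + X) = 1\<close>, \<open>L * (1 - X) = 1\<close> and the composed equation
    \<open>ODE'\<close>.\<close>
  define \<gamma> \<sigma> \<pi> where "\<gamma> = fps_const c" and "\<sigma> = fps_const (a + b)" and "\<pi> = fps_const (a * b)"
  note ks = ks[folded \<gamma>_def \<sigma>_def \<pi>_def]
  have J2: "J\<^sup>2 = (1 + ?X)\<^sup>2 * J ^ 4" and J3: "J ^ 3 = (1 + ?X) * J ^ 4"
    using J by algebra+
  \<comment> \<open>Since \<open>1 - K\<close> is the square of \<open>(1 - X) / (1 + X)\<close>,
    the term \<open>X^2 * A2 * K'^2\<close> is a multiple of the leading term of \<open>ODE'\<close>
    without any division by \<open>1 - X\<close>.\<close>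
  have "1 - K = (1 - ?X)\<^sup>2 * J\<^sup>2"
    unfolding K_def using J by algebra
  then have "?X\<^sup>2 * (A2 * (4 * (1 - ?X) * J ^ 3)\<^sup>2) = 4 * ?X * J\<^sup>2 * (K * (1 - K) * A2)"
    unfolding K_def by algebra
  also have "K * (1 - K) * A2 = \<pi> * G - (\<gamma> - (\<sigma> + 1) * K) * A1"
    using ODE'[folded \<gamma>_def \<pi>_def] unfolding ks by (simp add: algebra_simps)
  finally have A2: "?X\<^sup>2 * (A2 * (4 * (1 - ?X) * J ^ 3)\<^sup>2)
      = 4 * ?X * J\<^sup>2 * (\<pi> * G - (\<gamma> - (\<sigma> + 1) * K) * A1)" .
  let ?P = "(\<gamma> - 2 * \<sigma>) * ?X + (\<gamma> - 1) * ?X\<^sup>2"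
  \<comment> \<open>\<open>L + J\<close> equals \<open>2 / (1 - X^2)\<close>, and its pole at 1
    cancels against the factor \<open>1 - X\<close> of \<open>K'\<close>.\<close>
  have "(L + J) * (1 - ?X) * J ^ 3 = 2 * J ^ 4"
    using J L by algebra
  then have P: "?P * (L + J) * (?X * (A1 * (4 * (1 - ?X) * J ^ 3))) = 8 * ?X * ?P * J ^ 4 * A1"
    by algebra
  have coeff: "4 * \<gamma> * ?X * (1 - ?X) * J ^ 3 - 8 * ?X\<^sup>2 * (2 - ?X) * J ^ 4
      - 4 * ?X * J\<^sup>2 * (\<gamma> - (\<sigma> + 1) * K) = - (8 * ?X * ?P * J ^ 4)"
  proof -
    have "4 * ?X * J\<^sup>2 * (\<gamma> - (\<sigma> + 1) * K) = 4 * ?X * \<gamma> * J\<^sup>2 - 16 * ?X\<^sup>2 * (\<sigma> + 1) * J ^ 4"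
      unfolding K_def by algebra
    then show ?thesis unfolding J2 J3 by algebra
  qed
  have "?X * fps_deriv (?X * fps_deriv G) + (\<gamma> - 1) * (?X * fps_deriv G)
      = ?X\<^sup>2 * (A2 * (4 * (1 - ?X) * J ^ 3)\<^sup>2)
        + (4 * \<gamma> * ?X * (1 - ?X) * J ^ 3 - 8 * ?X\<^sup>2 * (2 - ?X) * J ^ 4) * A1"
    unfolding d G'' unfolding G' K'' unfolding K' by algebra
  also have "\<dots> = - (8 * ?X * ?P * J ^ 4 * A1) + 4 * \<pi> * ?X * J\<^sup>2 * G"
    unfolding A2 using coeff by algebra
  also have "\<dots> = - (?P * (L + J)) * (?X * fps_deriv G) + 4 * \<pi> * ?X * J\<^sup>2 * G"
    unfolding G' K' using P by algebra
  finally show ?thesis unfolding ks by simp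
qed

text \<open>In the pulled-back equation the multiplier \<open>P\<close> of the Euler derivative has
  bounded coefficients, and those of the multiplier \<open>Q\<close> of \<open>G\<close> grow at
  most linearly. Comparing coefficients and dividing by \<open>n\<close> yields the hypothesis of
  \<open>conv_radius_ge_1_if_bounded_by_partial_sums\<close> with \<open>d = c - 1\<close>.\<close>

lemma conv_radius_koebe_pullback:
  fixes A :: "complex fps" and a b c :: complex
  assumes ODE: "fps_X * (1 - fps_X) * fps_deriv (fps_deriv A)
     + (fps_const c - fps_const (a + b + 1) * fps_X) * fps_deriv A = fps_const (a * b) * A"
  shows "fps_conv_radius (A oo 4 * fps_X * (inverse (1 + fps_X))\<^sup>2) \<ge> 1"
proof -
  let ?X = "fps_X :: complex fps"
  define J L where "J = inverse (1 + ?X)" and "L = inverse (1 - ?X)"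
  define G where "G = A oo 4 * ?X * J\<^sup>2"
  define \<alpha> \<beta> where "\<alpha> = c - 2 * (a + b)" and "\<beta> = c - 1"
  define P where "P = (fps_const \<alpha> * ?X + fps_const \<beta> * ?X\<^sup>2) * (L + J)"
  define Q where "Q = fps_const (4 * a * b) * ?X * J\<^sup>2"
  have J_nth: "J $ n = (- 1) ^ n" for n
    unfolding J_def by (simp add: fps_inverse_fps_X_plus1)
  have L_nth: "L $ n = 1" for n
  proof (induction n)
    case 0
    show ?case by (simp add: L_def)
  next
    case (Suc n)
    have "L * (1 - ?X) = 1" unfolding L_def by (rule inverse_mult_eq_1) simp
    then have "(L * (1 - ?X)) $ Suc n = 0" by simp
    then show ?case using Suc by (simp add: algebra_simps)
  qed
  have "fps_deriv J = - J\<^sup>2"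
    unfolding J_def by (subst fps_inverse_deriv) (auto simp: field_simps)
  then have "J\<^sup>2 $ n = - fps_deriv J $ n" for n by simp
  then have J2_nth: "J\<^sup>2 $ n = of_nat (Suc n) * (- 1) ^ n" for n
    by (simp add: J_nth)
  have P0: "P $ 0 = 0" and Q0: "Q $ 0 = 0" by (simp_all add: P_def Q_def)
  define C where "C = 2 * (norm \<alpha> + norm \<beta>) + norm (4 * a * b)"
  have LJ: "norm ((L + J) $ n) \<le> 2" for n
    using norm_triangle_ineq[of 1 "(- 1) ^ n :: complex"] by (simp add: J_nth L_nth norm_power)
  have P_nth: "norm (P $ n) \<le> 2 * (norm \<alpha> + norm \<beta>)" for n
  proof -
    have "P $ n = (if n = 0 then 0 else \<alpha> * (L + J) $ (n - 1)) + (if n < 2 then 0 else \<beta> * (L + J) $ (n - 2))"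
      unfolding P_def distrib_right mult.assoc fps_add_nth[of "fps_const \<alpha> * _"] fps_mult_left_const_nth
      by (simp add: fps_X_power_mult_nth)
    also have "norm \<dots> \<le> norm \<alpha> * 2 + norm \<beta> * 2"
      using LJ by (intro order_trans[OF norm_triangle_ineq] add_mono)
        (auto simp: norm_mult intro!: mult_left_mono)
    finally show ?thesis by simp
  qed
  have Q_nth: "norm (Q $ n) \<le> norm (4 * a * b) * real n" for n
    unfolding Q_def mult.assoc fps_mult_left_const_nth
    by (cases n) (auto simp: J2_nth norm_mult norm_power simp del: of_nat_Suc)
  have "fps_conv_radius G \<ge> 1"
    unfolding fps_conv_radius_def
  proof (rule conv_radius_ge_1_if_bounded_by_partial_sums[where d = "c - 1" and C = C])
    fix n :: nat assume n: "n \<ge> 1"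
    have "?X * fps_deriv (?X * fps_deriv G) + fps_const (c - 1) * (?X * fps_deriv G)
      = Q * G - P * (?X * fps_deriv G)"
      using koebe_pullback_ODE[OF ODE] unfolding G_def P_def Q_def J_def L_def \<alpha>_def \<beta>_def by simp
    then have "(?X * fps_deriv (?X * fps_deriv G) + fps_const (c - 1) * (?X * fps_deriv G)) $ n
      = (Q * G) $ n - (P * (?X * fps_deriv G)) $ n"
      by simp
    moreover have euler: "(?X * fps_deriv H) $ k = of_nat k * H $ k" for H :: "complex fps" and k
      by (cases k) simp_all
    have "(?X * fps_deriv (?X * fps_deriv G) + fps_const (c - 1) * (?X * fps_deriv G)) $ n
        = of_nat n * (of_nat n + (c - 1)) * G $ n"
      unfolding fps_add_nth fps_mult_left_const_nth euler by (simp add: algebra_simps)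
    moreover have "(P * (?X * fps_deriv G)) $ n = (\<Sum>k=0..n. P $ k * (of_nat (n - k) * G $ (n - k)))"
      unfolding fps_mult_nth[of P] euler ..
    ultimately have "of_nat n * (of_nat n + (c - 1)) * G $ n =
        (\<Sum>k=0..n. Q $ k * G $ (n - k)) - (\<Sum>k=0..n. P $ k * (of_nat (n - k) * G $ (n - k)))"
      unfolding fps_mult_nth[of Q] by argo
    also have "\<dots> = (\<Sum>k=0..n. (Q $ k - P $ k * of_nat (n - k)) * G $ (n - k))"
      by (simp add: algebra_simps flip: sum_subtractf)
    also have "\<dots> = (\<Sum>k\<le>n. (Q $ (n - k) - P $ (n - k) * of_nat k) * G $ k)"
      by (rule sum.reindex_bij_witness[of _ "\<lambda>k. n - k" "\<lambda>k. n - k"]) auto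
    \<comment> \<open>The term \<open>k = n\<close> drops out because \<open>P\<close> and
      \<open>Q\<close> have no constant term, so only earlier coefficients of \<open>G\<close>
      remain.\<close>
    also have "\<dots> = (\<Sum>k<n. (Q $ (n - k) - P $ (n - k) * of_nat k) * G $ k)"
      by (simp add: P0 Q0 flip: lessThan_Suc_atMost)
    finally have eq: "of_nat n * (of_nat n + (c - 1)) * G $ n
      = (\<Sum>k<n. (Q $ (n - k) - P $ (n - k) * of_nat k) * G $ k)" .
    have "real n * (norm (of_nat n + (c - 1)) * norm (G $ n))
      = norm (\<Sum>k<n. (Q $ (n - k) - P $ (n - k) * of_nat k) * G $ k)"
      unfolding eq[symmetric] by (simp add: norm_mult)
    \<comment> \<open>Both contributions are of order \<open>n\<close>: the one from
      \<open>Q\<close> by linear growth, the one from \<open>P\<close> through the factor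
      \<open>k < n\<close>. This \<open>n\<close> cancels the one on the left.\<close>
    also have "\<dots> \<le> (\<Sum>k<n. (C * real n) * norm (G $ k))"
    proof (rule sum_norm_le)
      fix k assume "k \<in> {..<n}"
      then have k: "k < n" by simp
      have "norm (Q $ (n - k) - P $ (n - k) * of_nat k) \<le> norm (Q $ (n - k)) + norm (P $ (n - k)) * real k"
        by (rule order_trans[OF norm_triangle_ineq4]) (simp add: norm_mult)
      also have "\<dots> \<le> norm (4 * a * b) * real n + 2 * (norm \<alpha> + norm \<beta>) * real n"
        using k by (intro add_mono mult_mono P_nth order_trans[OF Q_nth] mult_left_mono) auto
      also have "\<dots> = C * real n" by (simp add: C_def algebra_simps)
      finally show "norm ((Q $ (n - k) - P $ (n - k) * of_nat k) * G $ k) \<le> C * real n * norm (G $ k)"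
        unfolding norm_mult by (rule mult_right_mono) auto
    qed
    also have "\<dots> = real n * (C * (\<Sum>k<n. norm (G $ k)))"
      by (simp add: sum_distrib_left mult_ac)
    finally show "norm (of_nat n + (c - 1)) * norm (G $ n) \<le> C * (\<Sum>k<n. norm (G $ k))"
      using n by simp
  qed
  then show ?thesis by (simp add: G_def J_def)
qed

section \<open>Geometry of the slit plane and of \<open>D1\<close>\<close>

declare csqrt.simps [simp del]

abbreviation slit_plane :: "complex set" where
  "slit_plane \<equiv> - complex_of_real ` {1..}"

lemma slit_plane_eq: "slit_plane = {z. Im z \<noteq> 0 \<or> Re z < 1}"
  by (auto simp: image_iff complex_eq_iff not_le)

lemma D1_eq: "D1 = {z. Im z \<noteq> 0 \<or> -1 < Re z \<and> Re z < 1}"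
  unfolding D1_def by (auto simp: image_iff complex_eq_iff not_le)

lemma open_slit_plane: "open slit_plane"
  unfolding slit_plane_eq
  by (intro open_Collect_disj open_Collect_neq open_Collect_less continuous_intros)

lemma open_D1: "open D1"
  unfolding D1_eq
  by (intro open_Collect_disj open_Collect_conj open_Collect_neq open_Collect_less continuous_intros)

lemma connected_if_star_shaped_0:
  fixes S :: "complex set"
  assumes "0 \<in> S" and "\<And>z t. z \<in> S \<Longrightarrow> 0 < t \<Longrightarrow> t \<le> 1 \<Longrightarrow> of_real t * z \<in> S"
  shows "connected S"
proof (rule starlike_imp_connected)
  have "closed_segment 0 z \<subseteq> S" if "z \<in> S" for z
  proof
    fix y assume "y \<in> closed_segment 0 z"
    then obtain t where "0 \<le> t" "t \<le> 1" "y = of_real t * z"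
      by (auto simp: in_segment scaleR_conv_of_real)
    then show "y \<in> S" using assms that by (cases "t = 0") auto
  qed
  then show "starlike S" unfolding starlike_def using assms(1) by blast
qed

lemma connected_slit_plane: "connected slit_plane"
proof (rule connected_if_star_shaped_0)
  fix z t assume z: "z \<in> slit_plane" and t: "0 < t" "t \<le> (1::real)"
  have "t * Re z < 1" if "Re z < 1"
  proof (cases "Re z \<le> 0")
    case True
    then show ?thesis using t mult_nonneg_nonpos[of t "Re z"] by linarith
  next
    case False
    then show ?thesis using t that mult_left_le_one_le[of "Re z" t] by linarith
  qed
  then show "of_real t * z \<in> slit_plane"
    using z t unfolding slit_plane_eq by auto
qed (simp add: slit_plane_eq)

lemma connected_D1: "connected D1"
proof (rule connected_if_star_shaped_0)
  fix z t assume z: "z \<in> D1" and t: "0 < t" "t \<le> (1::real)"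
  have "\<bar>t * Re z\<bar> < 1" if "\<bar>Re z\<bar> < 1"
    using t that mult_left_le_one_le[of "\<bar>Re z\<bar>" t] by (simp add: abs_mult)
  then show "of_real t * z \<in> D1"
    using z t unfolding D1_eq by (auto simp: abs_less_iff)
qed (simp add: D1_eq)

lemma ball_subset_slit_plane: "ball 0 1 \<subseteq> slit_plane"
proof
  fix z :: complex assume "z \<in> ball 0 1"
  then have "Re z < 1" using complex_Re_le_cmod[of z] by simp
  then show "z \<in> slit_plane" by (simp add: slit_plane_eq)
qed

text \<open>The slit plane is thus the domain on which \<open>csqrt (1 - z)\<close> stays off its
  branch cut.\<close>

lemma slit_plane_iff: "z \<in> slit_plane \<longleftrightarrow> 1 - z \<notin> \<real>\<^sub>\<le>\<^sub>0"
  unfolding slit_plane_eq by (auto simp: complex_nonpos_Reals_iff)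

lemma Re_csqrt_pos:
  assumes "w \<notin> \<real>\<^sub>\<le>\<^sub>0"
  shows "Re (csqrt w) > 0"
proof (rule ccontr)
  assume "\<not> Re (csqrt w) > 0"
  then have "Re (csqrt w) = 0" using Re_csqrt[of w] by simp
  then have "(csqrt w)\<^sup>2 = - of_real ((Im (csqrt w))\<^sup>2)"
    by (simp add: complex_eq_iff power2_eq_square)
  then have "w = of_real (- ((Im (csqrt w))\<^sup>2))" by simp
  then have "w \<in> \<real>\<^sub>\<le>\<^sub>0" by (metis nonpos_Reals_of_real_iff neg_le_0_iff_le zero_le_power2)
  with assms show False by simp
qed

text \<open>A point of the right half-plane is closer to 1 than to -1; hence
  \<open>(1 - s) / (1 + s)\<close> lies in the unit disc.\<close>

lemma norm_diff_less_norm_add: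
  fixes s :: complex
  assumes "Re s > 0"
  shows "norm (1 - s) < norm (1 + s)"
proof -
  have "(1 - Re s)\<^sup>2 < (1 + Re s)\<^sup>2" using assms by (simp add: power2_eq_square algebra_simps)
  then show ?thesis by (simp add: cmod_def)
qed

section \<open>The regularized function on the slit plane\<close>

text \<open>The continuation is \<open>G\<close> composed with the inverse \<open>T\<close> of
  \<open>4 t / (1 + t)^2\<close>. It is holomorphic because \<open>T\<close> maps the slit plane
  into the disc, where \<open>G\<close> converges, and it has the right germ because
  \<open>K\<close> undoes \<open>T\<close>.\<close>

lemma hyp_continuation_exists:
  "\<exists>F. F holomorphic_on slit_plane \<and>
       (\<forall>w\<in>ball 0 1. (\<lambda>n. pochhammer a n * pochhammer b n * rGamma (c + of_nat n) * w ^ n / fact n) sums F w)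
       \<and> F has_fps_expansion hyp_fps a b c"
proof -
  define A where "A = hyp_fps a b c"
  define K where "K = 4 * fps_X * (inverse (1 + fps_X :: complex fps))\<^sup>2"
  define G where "G = A oo K"
  have G1: "fps_conv_radius G \<ge> 1"
    unfolding G_def A_def K_def by (rule conv_radius_koebe_pullback[OF hyp_fps_ODE])
  \<comment> \<open>Solving \<open>z = 4 t / (1 + t)^2\<close> gives
    \<open>csqrt (1 - z) = (1 - t) / (1 + t)\<close> for the root inside the disc.\<close>
  define T where "T z = (1 - csqrt (1 - z)) / (1 + csqrt (1 - z))" for z
  define F where "F z = eval_fps G (T z)" for z
  have Re_pos: "Re (csqrt (1 - z)) > 0" if "z \<in> slit_plane" for z
    using that slit_plane_iff Re_csqrt_pos by blast
  have nz: "1 + csqrt (1 - z) \<noteq> 0" for z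
    using Re_csqrt[of "1 - z"] by (auto simp: complex_eq_iff)
  have T1: "norm (T z) < 1" if "z \<in> slit_plane" for z
    using norm_diff_less_norm_add[OF Re_pos[OF that]] nz[of z]
    by (simp add: T_def norm_divide divide_less_eq)
  have T_hol: "T holomorphic_on slit_plane"
    unfolding T_def using slit_plane_iff nz by (intro holomorphic_intros) auto
  have F_hol: "F holomorphic_on slit_plane"
    unfolding F_def
  proof (rule holomorphic_on_compose_gen[unfolded o_def, OF T_hol])
    show "eval_fps G holomorphic_on ball 0 1"
    proof (rule holomorphic_on_eval_fps, rule)
      fix x :: complex assume "x \<in> ball 0 1"
      then have "ereal (norm x) < 1" by simp
      from less_le_trans[OF this G1] show "x \<in> eball 0 (fps_conv_radius G)" by simp
    qed
  qed (use T1 in auto)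
  have KT: "4 * T z * (inverse (1 + T z))\<^sup>2 = z" for z
  proof -
    define s where "s = csqrt (1 - z)"
    have s: "1 + s \<noteq> 0" "z = 1 - s\<^sup>2" using nz by (auto simp: s_def)
    have "1 + T z = 2 / (1 + s)" using s by (simp add: T_def s_def[symmetric] field_simps)
    then have "4 * T z * (inverse (1 + T z))\<^sup>2 = 4 * ((1 - s) / (1 + s)) * ((1 + s) / 2)\<^sup>2"
      by (simp add: T_def s_def)
    also have "\<dots> = (1 - s) * (1 + s)" using s by (simp add: power2_eq_square)
    also have "\<dots> = z" using s by (simp add: power2_eq_square algebra_simps)
    finally show ?thesis .
  qed
  \<comment> \<open>Near 0 the formal composition \<open>G\<close> represents the composite
    function; substituting \<open>T z\<close>, which tends to 0, turns it into
    \<open>eval_fps A z\<close>.\<close>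
  have "(eval_fps A \<circ> (\<lambda>t. 4 * t * (inverse (1 + t))\<^sup>2)) has_fps_expansion G"
    unfolding G_def K_def A_def
    by (intro has_fps_expansion_compose eval_fps_has_fps_expansion conv_radius_hyp_pos
        fps_expansion_intros) (auto simp: fps_expansion_intros)
  then have "eventually (\<lambda>t. eval_fps G t = eval_fps A (4 * t * (inverse (1 + t))\<^sup>2)) (nhds 0)"
    by (simp add: has_fps_expansion_def)
  moreover have "filterlim T (nhds 0) (nhds 0)"
  proof -
    have "isCont T 0"
      using T_hol open_slit_plane by (auto simp: slit_plane_eq holomorphic_on_imp_continuous_on continuous_on_eq_continuous_at
          dest!: holomorphic_on_imp_continuous_on)
    moreover have "T 0 = 0" by (simp add: T_def)
    ultimately show ?thesis by (metis continuous_at tendsto_at_iff_tendsto_nhds)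
  qed
  ultimately have "eventually (\<lambda>z. eval_fps G (T z) = eval_fps A (4 * T z * (inverse (1 + T z))\<^sup>2)) (nhds 0)"
    by (rule eventually_compose_filterlim)
  then have "eventually (\<lambda>z. eval_fps A z = F z) (nhds 0)"
    by eventually_elim (simp add: F_def KT)
  then have exp: "F has_fps_expansion A"
    using conv_radius_hyp_pos by (simp add: has_fps_expansion_def A_def)
  have "(\<lambda>n. pochhammer a n * pochhammer b n * rGamma (c + of_nat n) * w ^ n / fact n) sums F w"
    if "w \<in> ball 0 1" for w
  proof -
    \<comment> \<open>A function holomorphic on the unit disc is there the sum of its Taylor series,
      so the hypergeometric series converges on the whole disc.\<close>
    have "F holomorphic_on eball 0 (ereal 1)"
      using F_hol ball_subset_slit_plane holomorphic_on_subset by simp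
    with exp have "(\<lambda>n. A $ n * w ^ n) sums F w"
      by (rule has_fps_expansion_imp_sums_complex) (use that in auto)
    then show ?thesis by (simp add: A_def hyp_fps_def hyp_coeff_def)
  qed
  with F_hol exp show ?thesis unfolding A_def by blast
qed

lemma
  shows hyp2F1_reg_holomorphic: "hyp2F1_reg a b c holomorphic_on slit_plane"
    and hyp2F1_reg_sums: "\<And>w. w \<in> ball 0 1 \<Longrightarrow>
       (\<lambda>n. pochhammer a n * pochhammer b n * rGamma (c + of_nat n) * w ^ n / fact n) sums hyp2F1_reg a b c w"
    and hyp2F1_reg_has_fps_expansion: "hyp2F1_reg a b c has_fps_expansion hyp_fps a b c"
proof -
  obtain F where F: "F holomorphic_on slit_plane"
    "\<And>w. w \<in> ball 0 1 \<Longrightarrow>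
       (\<lambda>n. pochhammer a n * pochhammer b n * rGamma (c + of_nat n) * w ^ n / fact n) sums F w"
    "F has_fps_expansion hyp_fps a b c"
    using hyp_continuation_exists[of a b c] by blast
  have eq: "hyp2F1_reg a b c z = F z" if "z \<in> slit_plane" for z
    unfolding hyp2F1_reg_def
  proof (rule analytic_extension_eqI[where \<xi> = 0])
    show "F w = (\<Sum>n. pochhammer a n * pochhammer b n * rGamma (c + of_nat n) * w ^ n / fact n)"
      if "w \<in> ball 0 1" for w
      using F(2)[OF that] by (simp add: sums_iff)
  qed (use F(1) that open_slit_plane connected_slit_plane ball_subset_slit_plane in
      \<open>auto simp: slit_plane_eq islimpt_ball\<close>)
  show "hyp2F1_reg a b c holomorphic_on slit_plane"
    using F(1) eq holomorphic_cong by (metis (no_types, lifting))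
  show "(\<lambda>n. pochhammer a n * pochhammer b n * rGamma (c + of_nat n) * w ^ n / fact n) sums hyp2F1_reg a b c w"
    if "w \<in> ball 0 1" for w
    using F(2)[OF that] eq that ball_subset_slit_plane by (metis subsetD)
  have "eventually (\<lambda>z. z \<in> slit_plane) (nhds 0)"
    by (rule eventually_nhds_in_open[OF open_slit_plane]) (simp add: slit_plane_eq)
  then have "eventually (\<lambda>z. F z = hyp2F1_reg a b c z) (nhds 0)"
    by eventually_elim (simp add: eq)
  then show "hyp2F1_reg a b c has_fps_expansion hyp_fps a b c"
    using F(3) has_fps_expansion_cong by blast
qed

text \<open>If \<open>c\<close> is not a nonpositive integer, the two series differ termwise by the
  factor \<open>Gamma c\<close>, and uniqueness of continuation carries this to the slit plane. Both
  cases of the definition thereby become one function.\<close>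

lemma hyp2F1_over_Gamma_eq_reg:
  assumes "z \<in> slit_plane"
  shows "hyp2F1_over_Gamma a b c z = hyp2F1_reg a b c z"
proof (cases "c \<in> \<int>\<^sub>\<le>\<^sub>0")
  case False
  then have "Gamma c \<noteq> 0" by (simp add: Gamma_eq_zero_iff)
  have "hyp2F1 a b c z = Gamma c * hyp2F1_reg a b c z"
    unfolding hyp2F1_def
  proof (rule analytic_extension_eqI[where \<xi> = 0])
    show "(\<lambda>z. Gamma c * hyp2F1_reg a b c z) holomorphic_on slit_plane"
      by (intro holomorphic_intros hyp2F1_reg_holomorphic)
    fix w :: complex assume w: "w \<in> ball 0 1"
    have "Gamma c * (pochhammer a n * pochhammer b n * rGamma (c + of_nat n) * w ^ n / fact n)
        = pochhammer a n * pochhammer b n / pochhammer c n * w ^ n / fact n" for n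
    proof -
      have "pochhammer c n \<noteq> 0" using False by (auto dest: pochhammer_eq_0_imp_nonpos_Int)
      moreover have "pochhammer c n * rGamma (c + of_nat n) = 1 / Gamma c"
        using pochhammer_rGamma[of c n] by (simp add: rGamma_inverse_Gamma inverse_eq_divide)
      ultimately have "Gamma c * rGamma (c + of_nat n) = 1 / pochhammer c n"
        using \<open>Gamma c \<noteq> 0\<close> by (simp add: field_simps)
      then show ?thesis by (simp add: mult_ac divide_inverse)
    qed
    with sums_mult[OF hyp2F1_reg_sums[OF w, of a b c], of "Gamma c"]
    have "(\<lambda>n. pochhammer a n * pochhammer b n / pochhammer c n * w ^ n / fact n)
        sums (Gamma c * hyp2F1_reg a b c w)"
      by (simp only:)
    then show "Gamma c * hyp2F1_reg a b c w
        = (\<Sum>n. pochhammer a n * pochhammer b n / pochhammer c n * w ^ n / fact n)"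
      by (simp add: sums_iff)
  qed (use assms open_slit_plane connected_slit_plane ball_subset_slit_plane in
      \<open>auto simp: slit_plane_eq islimpt_ball\<close>)
  then show ?thesis using False \<open>Gamma c \<noteq> 0\<close> by (simp add: hyp2F1_over_Gamma_def)
qed (simp add: hyp2F1_over_Gamma_def)

section \<open>The quadratic transformation\<close>

text \<open>As \<open>K ^ n\<close> is \<open>4^n X^n (1 + X)^(-2n)\<close>, the binomial prefactor
  merges with it into a single binomial series. The coefficient of \<open>X^N\<close> is then a
  finite sum that Chu-Vandermonde evaluates.\<close>

lemma hyp_fps_quadratic:
  fixes a b :: complex
  defines "c \<equiv> a - b + 1"
  shows "fps_binomial (- a) * (hyp_fps ((a + 1) / 2) (a / 2) c oo 4 * fps_X * (inverse (1 + fps_X))\<^sup>2)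
     = hyp_fps b a c"
proof (rule fps_ext)
  fix N
  define A where "A = hyp_fps ((a + 1) / 2) (a / 2) c"
  define K where "K = 4 * fps_X * (inverse (1 + fps_X :: complex fps))\<^sup>2"
  have K_power: "K ^ n = fps_const (4 ^ n) * (fps_X ^ n * fps_binomial (- 2 * of_nat n))" for n
    unfolding K_def fps_binomial_minus_one[symmetric] power_mult_distrib power_mult[symmetric]
      fps_binomial_power by (simp add: numeral_fps_const fps_const_power mult_ac)
  have K0: "(K ^ n) $ m = 0" if "m < n" for n m
    using that by (simp add: K_power fps_X_power_mult_nth)
  have prod_nth: "(fps_binomial (- a) * K ^ n) $ N = 4 ^ n * ((- (a + 2 * of_nat n)) gchoose (N - n))"
    if "n \<le> N" for n
  proof -
    have "fps_binomial (- a) * K ^ n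
      = fps_const (4 ^ n) * (fps_X ^ n * (fps_binomial (- a) * fps_binomial (- 2 * of_nat n)))"
      by (simp add: K_power mult_ac)
    also have "fps_binomial (- a) * fps_binomial (- 2 * of_nat n) = fps_binomial (- (a + 2 * of_nat n))"
      by (simp flip: fps_binomial_add_mult)
    finally show ?thesis using that by (simp add: fps_X_power_mult_nth)
  qed
  have "(fps_binomial (- a) * (A oo K)) $ N
      = (\<Sum>i=0..N. fps_binomial (- a) $ i * (\<Sum>n=0..N-i. A $ n * (K ^ n) $ (N - i)))"
    by (simp add: fps_mult_nth fps_compose_nth)
  \<comment> \<open>\<open>K ^ n\<close> starts at order \<open>n\<close>, so the inner range can be
    extended to \<open>N\<close>, after which the sums may be swapped.\<close>
  also have "\<dots> = (\<Sum>i=0..N. fps_binomial (- a) $ i * (\<Sum>n=0..N. A $ n * (K ^ n) $ (N - i)))"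
    by (intro sum.cong refl arg_cong2[where f = "(*)"] sum.mono_neutral_left) (auto simp: K0)
  also have "\<dots> = (\<Sum>n=0..N. A $ n * (fps_binomial (- a) * K ^ n) $ N)"
    unfolding sum_distrib_left fps_mult_nth by (subst sum.swap) (simp add: mult_ac)
  also have "\<dots> = (\<Sum>n\<le>N. pochhammer a N * rGamma (c + of_nat N) / fact N *
      (of_nat (N choose n) * pochhammer (a + of_nat N) n * pochhammer (1 - c - of_nat N) (N - n)))"
    unfolding atLeast0AtMost
  proof (rule sum.cong[OF refl])
    fix n assume "n \<in> {..N}"
    then have n: "n \<le> N" by simp
    \<comment> \<open>The duplication formula for Pochhammer symbols absorbs the power of 4; this is
      why the parameters are \<open>(a + 1) / 2\<close> and \<open>a / 2\<close>.\<close>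
    have double: "4 ^ n * (pochhammer ((a + 1) / 2) n * pochhammer (a / 2) n) = pochhammer a (2 * n)"
      using pochhammer_double[of "a / 2" n] power_mult[of "2::complex" 2 n]
      by (simp add: add_divide_distrib mult_ac)
    have "pochhammer a (2 * n) * pochhammer (a + 2 * of_nat n) (N - n) = pochhammer a (N + n)"
      using pochhammer_product'[of a "2 * n" "N - n"] n by (simp add: add.commute)
    also have "\<dots> = pochhammer a N * pochhammer (a + of_nat N) n"
      by (rule pochhammer_product')
    finally have shift: "pochhammer a (2 * n) * pochhammer (a + 2 * of_nat n) (N - n)
      = pochhammer a N * pochhammer (a + of_nat N) n" .
    have "pochhammer (1 - c - of_nat N) (N - n) = (- 1) ^ (N - n) * pochhammer (c + of_nat n) (N - n)"
      using pochhammer_minus[of "c + of_nat N - 1" "N - n"] n by (simp add: of_nat_diff algebra_simps)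
    moreover have "rGamma (c + of_nat n) = pochhammer (c + of_nat n) (N - n) * rGamma (c + of_nat N)"
      using pochhammer_rGamma[of "c + of_nat n" "N - n"] n by (simp add: of_nat_diff)
    ultimately have sign: "(- 1) ^ (N - n) * rGamma (c + of_nat n)
      = pochhammer (1 - c - of_nat N) (N - n) * rGamma (c + of_nat N)" by simp
    have "A $ n * (fps_binomial (- a) * K ^ n) $ N
      = (4 ^ n * (pochhammer ((a + 1) / 2) n * pochhammer (a / 2) n)) * pochhammer (a + 2 * of_nat n) (N - n)
        * ((- 1) ^ (N - n) * rGamma (c + of_nat n)) / (fact n * fact (N - n))"
      unfolding prod_nth[OF n] gbinomial_pochhammer
      by (simp add: A_def hyp_fps_def hyp_coeff_def mult_ac add.commute)
    also have "\<dots> = pochhammer a N * pochhammer (a + of_nat N) n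
        * (pochhammer (1 - c - of_nat N) (N - n) * rGamma (c + of_nat N)) / (fact n * fact (N - n))"
      unfolding double shift sign ..
    also have "\<dots> = pochhammer a N * rGamma (c + of_nat N) / fact N *
      (of_nat (N choose n) * pochhammer (a + of_nat N) n * pochhammer (1 - c - of_nat N) (N - n))"
      using n by (simp add: binomial_fact)
    finally show "A $ n * (fps_binomial (- a) * K ^ n) $ N = \<dots>" .
  qed
  \<comment> \<open>Chu-Vandermonde; the relation \<open>c = a - b + 1\<close> makes the resulting
    parameter equal to \<open>b\<close>.\<close>
  also have "\<dots> = pochhammer a N * rGamma (c + of_nat N) / fact N
      * pochhammer (a + of_nat N + (1 - c - of_nat N)) N"
    unfolding sum_distrib_left[symmetric] pochhammer_binomial_sum ..
  also have "a + of_nat N + (1 - c - of_nat N) = b" by (simp add: c_def)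
  also have "pochhammer a N * rGamma (c + of_nat N) / fact N * pochhammer b N = hyp_fps b a c $ N"
    by (simp add: hyp_fps_def hyp_coeff_def mult_ac)
  finally show "(fps_binomial (- a) * (A oo K)) $ N = hyp_fps b a c $ N" .
qed

text \<open>One minus the image is the square of \<open>(1 - t) / (1 + t)\<close>, which has
  positive real part, and such squares avoid the nonpositive reals.\<close>

lemma disc_to_slit_plane:
  assumes "norm t < 1"
  shows "4 * t / (1 + t)\<^sup>2 \<in> slit_plane"
proof -
  define s where "s = (1 - t) / (1 + t)"
  have t: "1 + t \<noteq> 0" using assms by (metis add_eq_0_iff norm_minus_cancel norm_one less_irrefl)
  have "Re ((1 - t) * cnj (1 + t)) = 1 - (norm t)\<^sup>2"
    by (simp add: cmod_power2) (simp add: power2_eq_square algebra_simps)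
  also have "\<dots> > 0" using assms by (simp add: power_less_one_iff abs_square_less_1)
  finally have "Re s > 0"
    using t by (simp add: s_def complex_div_cnj[of "1 - t"])
  moreover have "1 - 4 * t / (1 + t)\<^sup>2 = s\<^sup>2"
    using t by (simp add: s_def field_simps) (simp add: power2_eq_square algebra_simps)
  moreover have "s\<^sup>2 \<notin> \<real>\<^sub>\<le>\<^sub>0" if "Re s > 0"
  proof
    assume "s\<^sup>2 \<in> \<real>\<^sub>\<le>\<^sub>0"
    then have "Im s = 0" "Re s * Re s - Im s * Im s \<le> 0"
      using that by (auto simp: complex_nonpos_Reals_iff power2_eq_square)
    then show False using that by (simp add: mult_le_0_iff)
  qed
  ultimately show ?thesis unfolding slit_plane_iff by simp
qed

text \<open>The formal identity equates the germs at 0, and both sides are holomorphic on the unit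
  disc.\<close>

lemma hyp2F1_reg_quadratic:
  assumes "norm t < 1" and c: "c = a - b + 1"
  shows "hyp2F1_reg ((a + 1) / 2) (a / 2) c (4 * t / (1 + t)\<^sup>2) = (1 + t) powr a * hyp2F1_reg b a c t"
proof -
  define f where "f t = (1 + t) powr (- a) * hyp2F1_reg ((a + 1) / 2) (a / 2) c (4 * t * (inverse (1 + t))\<^sup>2)" for t
  have nz: "1 + t \<noteq> 0" if "norm t < 1" for t :: complex
    using that by (metis add_eq_0_iff norm_minus_cancel norm_one less_irrefl)
  have eq: "4 * t * (inverse (1 + t))\<^sup>2 = 4 * t / (1 + t)\<^sup>2" for t :: complex
    by (simp add: divide_inverse power_inverse)
  have "(\<lambda>t. (1 + t) powr (- a) * (hyp2F1_reg ((a + 1) / 2) (a / 2) c \<circ> (\<lambda>t. 4 * t * (inverse (1 + t))\<^sup>2)) t)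
      has_fps_expansion hyp_fps b a c"
    unfolding hyp_fps_quadratic[of a b, symmetric] c
    by (intro has_fps_expansion_mult has_fps_expansion_compose hyp2F1_reg_has_fps_expansion
        fps_expansion_intros) auto
  then have "(\<lambda>t. f t - hyp2F1_reg b a c t) has_fps_expansion (hyp_fps b a c - hyp_fps b a c)"
    unfolding f_def o_def by (intro has_fps_expansion_diff hyp2F1_reg_has_fps_expansion)
  then have exp: "(\<lambda>t. f t - hyp2F1_reg b a c t) has_fps_expansion 0" by simp
  have "f t - hyp2F1_reg b a c t = 0"
  proof (rule has_fps_expansion_0_analytic_continuation[OF exp, where A = "ball 0 1"])
    have "(\<lambda>t. hyp2F1_reg ((a + 1) / 2) (a / 2) c (4 * t * (inverse (1 + t))\<^sup>2)) holomorphic_on ball 0 1"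
    proof (rule holomorphic_on_compose_gen[unfolded o_def, OF _ hyp2F1_reg_holomorphic])
      show "(\<lambda>t. 4 * t * (inverse (1 + t))\<^sup>2) holomorphic_on ball 0 1"
        using nz by (intro holomorphic_intros) auto
      show "(\<lambda>t. 4 * t * (inverse (1 + t))\<^sup>2) ` ball 0 1 \<subseteq> slit_plane"
        unfolding eq image_subset_iff using disc_to_slit_plane by simp
    qed
    moreover have "1 + t \<notin> \<real>\<^sub>\<le>\<^sub>0" if "norm t < 1" for t :: complex
      using that abs_Re_le_cmod[of t] by (auto simp: complex_nonpos_Reals_iff)
    ultimately show "(\<lambda>t. f t - hyp2F1_reg b a c t) holomorphic_on ball 0 1"
      unfolding f_def using ball_subset_slit_plane
      by (intro holomorphic_intros) (auto intro: holomorphic_on_subset[OF hyp2F1_reg_holomorphic])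
  qed (use assms in auto)
  then show ?thesis
    using nz[OF assms(1)] by (simp add: f_def eq powr_minus field_simps)
qed

text \<open>The two arguments have opposite signs, so their sum stays strictly between
  \<open>-pi\<close> and \<open>pi\<close>.\<close>

lemma Ln_mult_opposite:
  assumes "Im z * Im w < 0"
  shows "Ln (z * w) = Ln z + Ln w"
proof -
  have nz: "z \<noteq> 0" "w \<noteq> 0" using assms by auto
  have "- pi < Im (Ln z + Ln w)" "Im (Ln z + Ln w) < pi"
    using assms Im_Ln_pos_lt[OF nz(1)] Im_Ln_pos_lt[OF nz(2)] Im_Ln_pos_le[OF nz(1)] Im_Ln_pos_le[OF nz(2)]
      mpi_less_Im_Ln[OF nz(1)] mpi_less_Im_Ln[OF nz(2)] Im_Ln_le_pi[OF nz(1)] Im_Ln_le_pi[OF nz(2)]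
    by (auto simp: mult_less_0_iff)
  with nz show ?thesis by (simp add: Ln_times)
qed

section \<open>Boundary values of the Legendre function\<close>

lemma powr_mult_opposite:
  assumes "Im z * Im w < 0"
  shows "(z * w) powr a = z powr a * w powr a"
proof -
  have "z \<noteq> 0" "w \<noteq> 0" using assms by auto
  then show ?thesis
    by (simp add: powr_def Ln_mult_opposite[OF assms] distrib_left exp_add)
qed

text \<open>Negation changes the principal argument by \<open>-pi\<close> in the upper half-plane
  and by \<open>pi\<close> in the lower one.\<close>

lemma powr_uminus:
  assumes "Im z \<noteq> 0"
  shows "(- z) powr a = exp (- sgn (Im z) * \<i> * of_real pi * a) * z powr a"
proof -
  have "z \<noteq> 0" using assms by auto
  then show ?thesis
    using assms by (auto simp: powr_def Ln_minus exp_add[symmetric] algebra_simps sgn_if)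
qed

lemma one_minus_square_D1:
  assumes "x \<in> D1"
  shows "1 - x\<^sup>2 \<notin> \<real>\<^sub>\<le>\<^sub>0"
proof
  assume "1 - x\<^sup>2 \<in> \<real>\<^sub>\<le>\<^sub>0"
  then have *: "Re x * Im x = 0" "Re x * Re x - Im x * Im x \<ge> 1"
    by (auto simp: complex_nonpos_Reals_iff power2_eq_square)
  have "Im x = 0"
  proof (rule ccontr)
    assume "Im x \<noteq> 0"
    then have "Im x * Im x \<le> - 1" using * by simp
    with zero_le_square[of "Im x"] show False by linarith
  qed
  with * assms have "\<bar>Re x\<bar> < 1" "1 \<le> (Re x)\<^sup>2"
    by (auto simp: D1_eq power2_eq_square)
  then show False by (simp add: abs_square_less_1[symmetric])
qed

text \<open>The numbers \<open>z - \<i> * s\<close> and \<open>z + \<i> * s\<close> are reciprocal,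
  and their squared norms differ by \<open>4 * (Im z * Re s - Re z * Im s)\<close>, which shows that
  the first is the smaller one.\<close>

lemma joukowski_upper:
  assumes s: "s\<^sup>2 = 1 - z\<^sup>2" "Re s > 0" and z: "Im z > 0"
  shows "norm (z - \<i> * s) < 1 \<and> Im (z - \<i> * s) < 0"
proof -
  define w w' where "w = z - \<i> * s" and "w' = z + \<i> * s"
  have ww': "w * w' = 1"
    using s by (simp add: w_def w'_def algebra_simps flip: power2_eq_square)
  \<comment> \<open>The imaginary part of \<open>s^2 = 1 - z^2\<close> forces \<open>Re z\<close>
    and \<open>Im s\<close> to have opposite signs or one of them to vanish.\<close>
  have "Re s * Im s = - (Re z * Im z)"
    using arg_cong[OF s(1), of Im] by (simp add: power2_eq_square mult.commute)
  then have "Im z * (Re z * Im s) = - (Re s * (Im s)\<^sup>2)"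
    by (simp add: power2_eq_square algebra_simps)
  also have "\<dots> \<le> 0" using s by simp
  finally have "Re z * Im s \<le> 0" using z by (simp add: mult_le_0_iff)
  moreover have "Im z * Re s > 0" using z s by simp
  ultimately have "(norm w)\<^sup>2 < (norm w')\<^sup>2"
    unfolding cmod_power2 by (simp add: w_def w'_def power2_eq_square algebra_simps)
  then have less: "norm w < norm w'" by (rule power2_less_imp_less) simp
  have prod: "norm w * norm w' = 1" using ww' by (metis norm_mult norm_one)
  have "norm w < 1"
  proof (rule ccontr)
    assume "\<not> norm w < 1"
    then have "norm w * norm w' > 1 * 1" using less by (intro mult_le_less_imp_less) auto
    then show False using prod by simp
  qed
  have w0: "w \<noteq> 0" using ww' by auto
  \<comment> \<open>Being the reciprocal of \<open>w\<close>, \<open>w'\<close> is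
    \<open>cnj w\<close> over the squared norm. Taking imaginary parts in
    \<open>w + w' = 2 z\<close> then determines the sign of \<open>Im w\<close>.\<close>
  have "w' * of_real ((norm w)\<^sup>2) = w * w' * cnj w"
    by (simp only: complex_norm_square mult_ac)
  then have "w' = cnj w / of_real ((norm w)\<^sup>2)"
    using w0 ww' by (simp add: eq_divide_eq)
  then have "Im w' = - Im w / (norm w)\<^sup>2" by simp
  moreover have "2 * Im z = Im w + Im w'"
    by (simp add: w_def w'_def)
  ultimately have "2 * Im z = Im w * (1 - 1 / (norm w)\<^sup>2)"
    by (simp add: right_diff_distrib)
  then have "Im w * (1 - 1 / (norm w)\<^sup>2) > 0" using z by linarith
  moreover have "1 - 1 / (norm w)\<^sup>2 < 0"
    using \<open>norm w < 1\<close> w0 by (simp add: power_less_one_iff)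
  ultimately have "Im w < 0" by (simp add: zero_less_mult_iff)
  with \<open>norm w < 1\<close> show ?thesis by (simp add: w_def)
qed

text \<open>The lower half-plane reduces to the upper one by \<open>z \<mapsto> -z\<close>. The
  opposite signs of the imaginary parts are what later splits the principal power of
  \<open>z * w\<close>.\<close>

lemma joukowski:
  assumes z: "Im z \<noteq> 0"
  defines "w \<equiv> z - sgn (Im z) * \<i> * csqrt (1 - z\<^sup>2)"
  shows "norm w < 1" "Im z * Im w < 0" "1 + w\<^sup>2 = 2 * (z * w)"
proof -
  let ?s = "csqrt (1 - z\<^sup>2)"
  have "z \<in> D1" using z by (simp add: D1_eq)
  then have s: "Re ?s > 0" by (intro Re_csqrt_pos one_minus_square_D1)
  have "norm w < 1 \<and> Im z * Im w < 0"
  proof (cases "Im z > 0")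
    case True
    then show ?thesis
      using joukowski_upper[of ?s z] s by (simp add: w_def mult_less_0_iff)
  next
    case False
    then have neg: "Im (- z) > 0" "w = - (- z - \<i> * ?s)" using z by (auto simp: w_def)
    have "norm (- z - \<i> * ?s) < 1 \<and> Im (- z - \<i> * ?s) < 0"
      by (rule joukowski_upper) (use s neg in auto)
    then show ?thesis unfolding neg(2) norm_minus_cancel using neg(1) by (simp add: mult_less_0_iff)
  qed
  then show "norm w < 1" "Im z * Im w < 0" by auto
  have "(z - w)\<^sup>2 = z\<^sup>2 - 1"
    using z by (simp add: w_def power_mult_distrib sgn_if)
  then show "1 + w\<^sup>2 = 2 * (z * w)"
    by (simp add: power2_eq_square algebra_simps)
qed

text \<open>At \<open>t = w^2\<close> the argument \<open>4 t / (1 + t)^2\<close> is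
  \<open>1 / z^2\<close>, so the quadratic transformation applies with
  \<open>a = \<nu> + \<mu> + 1\<close> and \<open>b = \<mu> + 1/2\<close>. Its factor
  \<open>(1 + w^2)^a = (2 z w)^a\<close> cancels the power of \<open>z\<close> in the denominator
  and leaves \<open>2^\<mu>\<close>.\<close>

lemma legendre_Q_off_real_axis:
  assumes z: "Im z \<noteq> 0" and w: "norm w < 1" "Im z * Im w < 0" "1 + w\<^sup>2 = 2 * (z * w)"
  shows "legendre_Q \<nu> \<mu> z =
    exp (\<i> * of_real pi * \<mu>) * exp (sgn (Im z) * \<i> * of_real pi * \<mu> / 2) *
    (of_real (sqrt pi) * 2 powr \<mu> * (1 - z\<^sup>2) powr (\<mu> / 2) * Gamma (\<nu> + \<mu> + 1) *
      (w powr (\<nu> + \<mu> + 1) * hyp2F1_reg (\<mu> + 1 / 2) (\<nu> + \<mu> + 1) (\<nu> + 3 / 2) (w\<^sup>2)))"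
proof -
  define a where "a = \<nu> + \<mu> + 1"
  define H where "H = hyp2F1_reg (\<mu> + 1 / 2) a (\<nu> + 3 / 2) (w\<^sup>2)"
  have nz: "z \<noteq> 0" "w \<noteq> 0" using w by auto
  have w2: "norm (w\<^sup>2) < 1" using w by (simp add: norm_power power_less_one_iff)
  have inv: "4 * w\<^sup>2 / (1 + w\<^sup>2)\<^sup>2 = 1 / z\<^sup>2"
    unfolding w(3) using nz by (simp add: power_mult_distrib)
  have "hyp2F1_over_Gamma ((a + 1) / 2) (a / 2) (\<nu> + 3 / 2) (1 / z\<^sup>2)
      = hyp2F1_reg ((a + 1) / 2) (a / 2) (\<nu> + 3 / 2) (1 / z\<^sup>2)"
    using disc_to_slit_plane[OF w2] unfolding inv by (rule hyp2F1_over_Gamma_eq_reg)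
  also have "\<dots> = (1 + w\<^sup>2) powr a * H"
    unfolding H_def inv[symmetric]
    by (rule hyp2F1_reg_quadratic[OF w2]) (simp add: a_def)
  also have "(1 + w\<^sup>2) powr a = 2 powr a * (z powr a * w powr a)"
    unfolding w(3) using powr_times_real_left[of 2 "z * w" a] powr_mult_opposite[OF w(2), of a] by simp
  finally have F: "hyp2F1_over_Gamma ((a + 1) / 2) (a / 2) (\<nu> + 3 / 2) (1 / z\<^sup>2)
      = 2 powr a * (z powr a * w powr a) * H" .
  have two: "2 powr a = 2 powr (\<nu> + 1) * (2 powr \<mu> :: complex)"
    by (simp add: a_def algebra_simps flip: powr_add)
  \<comment> \<open>\<open>1 + z\<close> and \<open>1 - z\<close> lie in opposite half-planes, so
    their powers combine; replacing \<open>z - 1\<close> by \<open>1 - z\<close> produces the phase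
    that depends on the half-plane.\<close>
  have "0 < Im z * Im z" using z not_real_square_gt_zero by blast
  then have "Im (1 + z) * Im (1 - z) < 0" by simp
  from powr_mult_opposite[OF this, of "\<mu> / 2"]
  have "(1 + z) powr (\<mu> / 2) * (1 - z) powr (\<mu> / 2) = (1 - z\<^sup>2) powr (\<mu> / 2)"
    by (simp add: power2_eq_square algebra_simps)
  moreover have "(z - 1) powr (\<mu> / 2) = exp (sgn (Im z) * \<i> * of_real pi * \<mu> / 2) * (1 - z) powr (\<mu> / 2)"
    using powr_uminus[of "1 - z" "\<mu> / 2"] z by simp
  ultimately have P: "(z + 1) powr (\<mu> / 2) * (z - 1) powr (\<mu> / 2)
      = exp (sgn (Im z) * \<i> * of_real pi * \<mu> / 2) * (1 - z\<^sup>2) powr (\<mu> / 2)"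
    by (simp add: add.commute mult_ac)
  have params: "(\<nu> + \<mu> + 2) / 2 = (a + 1) / 2" "(\<nu> + \<mu> + 1) / 2 = a / 2" "\<nu> + \<mu> + 1 = a"
    by (simp_all add: a_def)
  show ?thesis
    unfolding legendre_Q_def params F P two H_def[symmetric]
    using nz by (simp add: field_simps)
qed

text \<open>For \<open>\<sigma> = -1\<close> this is, up to a constant phase, the continuation of
  \<open>legendre_Q\<close> from the upper half-plane to \<open>D1\<close>, and for
  \<open>\<sigma> = 1\<close> from the lower one.\<close>

definition ferrers_branch :: "complex \<Rightarrow> complex \<Rightarrow> complex \<Rightarrow> complex \<Rightarrow> complex" where
  "ferrers_branch \<sigma> \<nu> \<mu> z =
    (let w = z + \<sigma> * \<i> * csqrt (1 - z\<^sup>2) in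
     of_real (sqrt pi) * 2 powr \<mu> * (1 - z\<^sup>2) powr (\<mu> / 2) * Gamma (\<nu> + \<mu> + 1) *
      (w powr (\<nu> + \<mu> + 1) * hyp2F1_reg (\<mu> + 1 / 2) (\<nu> + \<mu> + 1) (\<nu> + 3 / 2) (w\<^sup>2)))"

text \<open>For real nonzero \<open>r\<close>, the modulus of \<open>r + 1 / r\<close> is at least
  2, which would put \<open>x\<close> on one of the cuts.\<close>

lemma Im_joukowski_D1:
  assumes x: "x \<in> D1" and "w * w' = 1" "w + w' = 2 * x"
  shows "Im w \<noteq> 0"
proof
  assume "Im w = 0"
  then obtain r where r: "w = of_real r" by (metis complex_is_Real_iff Reals_cases)
  have "r \<noteq> 0" using assms(2) r by auto
  then have "w' = of_real (1 / r)" using assms(2) r by (simp add: field_simps)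
  then have x_eq: "x = of_real ((r + 1 / r) / 2)" using assms(3) r by (simp add: field_simps)
  then have "Im x = 0" "Re x = (r + 1 / r) / 2"
    by (simp_all only: Im_complex_of_real Re_complex_of_real)
  with x have "\<bar>(r + 1 / r) / 2\<bar> < 1" by (auto simp: D1_eq)
  then have "\<bar>r\<bar> * \<bar>r + 1 / r\<bar> < \<bar>r\<bar> * 2"
    using \<open>r \<noteq> 0\<close> by (intro mult_strict_left_mono) auto
  moreover have "r * (r + 1 / r) = r\<^sup>2 + 1"
    using \<open>r \<noteq> 0\<close> by (simp add: field_simps power2_eq_square)
  ultimately have "r\<^sup>2 + 1 < 2 * \<bar>r\<bar>"
    by (simp flip: abs_mult)
  moreover have "(\<bar>r\<bar> - 1)\<^sup>2 \<ge> 0" by simp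
  ultimately show False by (simp add: power2_diff)
qed

lemma square_in_slit_plane:
  assumes "Im w \<noteq> 0"
  shows "w\<^sup>2 \<in> slit_plane"
proof (cases "Re w = 0")
  case True
  have "0 \<le> Im w * Im w" by simp
  then have "Re (w\<^sup>2) < 1" unfolding power2_eq_square times_complex.sel True by linarith
  then show ?thesis unfolding slit_plane_eq by simp
next
  case False
  then have "Im (w\<^sup>2) \<noteq> 0" using assms by (simp add: power2_eq_square)
  then show ?thesis unfolding slit_plane_eq by simp
qed

lemma joukowski_branch:
  assumes x: "x \<in> D1" and \<sigma>: "\<sigma>\<^sup>2 = 1"
  shows "Im (x + \<sigma> * \<i> * csqrt (1 - x\<^sup>2)) \<noteq> 0"
proof (rule Im_joukowski_D1[OF x])
  have "(x + \<sigma> * \<i> * csqrt (1 - x\<^sup>2)) * (x - \<sigma> * \<i> * csqrt (1 - x\<^sup>2))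
    = x\<^sup>2 + \<sigma>\<^sup>2 * (csqrt (1 - x\<^sup>2))\<^sup>2"
    by (simp only: power2_eq_square) (simp add: algebra_simps)
  then show "(x + \<sigma> * \<i> * csqrt (1 - x\<^sup>2)) * (x - \<sigma> * \<i> * csqrt (1 - x\<^sup>2)) = 1"
    by (simp add: \<sigma>)
qed simp

text \<open>On \<open>D1\<close> every ingredient avoids its cut: \<open>1 - z^2\<close> is off the
  nonpositive reals, \<open>w\<close> is not real, and hence \<open>w^2\<close> is in the slit
  plane.\<close>

lemma ferrers_branch_holomorphic:
  assumes "\<sigma>\<^sup>2 = 1"
  shows "ferrers_branch \<sigma> \<nu> \<mu> holomorphic_on D1"
proof -
  let ?w = "\<lambda>z. z + \<sigma> * \<i> * csqrt (1 - z\<^sup>2)"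
  have w: "?w holomorphic_on D1"
    by (intro holomorphic_intros one_minus_square_D1)
  have "(\<lambda>z. hyp2F1_reg (\<mu> + 1 / 2) (\<nu> + \<mu> + 1) (\<nu> + 3 / 2) ((?w z)\<^sup>2)) holomorphic_on D1"
  proof (rule holomorphic_on_compose_gen[unfolded o_def, OF _ hyp2F1_reg_holomorphic])
    show "(\<lambda>z. (?w z)\<^sup>2) holomorphic_on D1" by (intro holomorphic_intros w)
    show "(\<lambda>z. (?w z)\<^sup>2) ` D1 \<subseteq> slit_plane"
      by (intro image_subsetI square_in_slit_plane joukowski_branch assms)
  qed
  moreover have "?w z \<notin> \<real>\<^sub>\<le>\<^sub>0" if "z \<in> D1" for z
    using joukowski_branch[OF that assms] by (auto simp: complex_nonpos_Reals_iff)
  ultimately show ?thesis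
    unfolding ferrers_branch_def Let_def
    by (intro holomorphic_intros w one_minus_square_D1)
qed

text \<open>The sign \<open>\<sigma>\<close> handles both half-planes at once. There
  \<open>legendre_Q\<close> is a constant times a branch that is continuous at the boundary
  point.\<close>

lemma Lim_legendre_Q:
  fixes x \<sigma> :: real
  assumes x: "-1 < x" "x < 1" and \<sigma>: "\<sigma> = 1 \<or> \<sigma> = -1"
  shows "Lim (at (of_real x) within {z. \<sigma> * Im z > 0}) (legendre_Q \<nu> \<mu>)
    = exp (\<i> * of_real pi * \<mu>) * exp (\<sigma> * \<i> * of_real pi * \<mu> / 2) * ferrers_branch (- \<sigma>) \<nu> \<mu> (of_real x)"
proof (rule tendsto_Lim)
  let ?S = "{z::complex. \<sigma> * Im z > 0}"
  let ?x = "complex_of_real x"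
  have "?x islimpt ?S"
    unfolding islimpt_approachable
  proof (intro allI impI)
    fix e :: real assume e: "e > 0"
    have "dist (?x + of_real (\<sigma> * (e / 2)) * \<i>) ?x < e"
      using e \<sigma> by (auto simp: dist_norm norm_mult)
    then show "\<exists>y\<in>?S. y \<noteq> ?x \<and> dist y ?x < e"
      using e \<sigma> by (intro bexI[of _ "?x + of_real (\<sigma> * (e / 2)) * \<i>"]) auto
  qed
  then show "at ?x within ?S \<noteq> bot" by (simp add: trivial_limit_within)
  have D1: "?x \<in> D1" using x by (simp add: D1_eq)
  have "(ferrers_branch (- \<sigma>) \<nu> \<mu> \<longlongrightarrow> ferrers_branch (- \<sigma>) \<nu> \<mu> ?x) (at ?x within ?S)"
  proof -
    have "ferrers_branch (- \<sigma>) \<nu> \<mu> holomorphic_on D1"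
      by (rule ferrers_branch_holomorphic) (use \<sigma> in auto)
    then have "isCont (ferrers_branch (- \<sigma>) \<nu> \<mu>) ?x"
      using D1 open_D1 by (metis continuous_on_eq_continuous_at holomorphic_on_imp_continuous_on)
    from continuous_at_imp_continuous_at_within[OF this] show ?thesis
      unfolding continuous_within .
  qed
  then have "((\<lambda>z. exp (\<i> * of_real pi * \<mu>) * exp (\<sigma> * \<i> * of_real pi * \<mu> / 2) * ferrers_branch (- \<sigma>) \<nu> \<mu> z)
    \<longlongrightarrow> exp (\<i> * of_real pi * \<mu>) * exp (\<sigma> * \<i> * of_real pi * \<mu> / 2) * ferrers_branch (- \<sigma>) \<nu> \<mu> ?x) (at ?x within ?S)"
    by (rule tendsto_mult_left)
  moreover have "eventually (\<lambda>z. exp (\<i> * of_real pi * \<mu>) * exp (\<sigma> * \<i> * of_real pi * \<mu> / 2) * ferrers_branch (- \<sigma>) \<nu> \<mu> z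
      = legendre_Q \<nu> \<mu> z) (at ?x within ?S)"
    unfolding eventually_at_filter
  proof (rule always_eventually, intro allI impI)
    fix z assume "z \<in> ?S"
    then have z: "Im z \<noteq> 0" "sgn (Im z) = \<sigma>" using \<sigma> by (auto simp: sgn_if)
    show "exp (\<i> * of_real pi * \<mu>) * exp (\<sigma> * \<i> * of_real pi * \<mu> / 2) * ferrers_branch (- \<sigma>) \<nu> \<mu> z
      = legendre_Q \<nu> \<mu> z"
      using legendre_Q_off_real_axis[OF z(1) joukowski[OF z(1)], of \<nu> \<mu>] z(2)
      by (simp add: ferrers_branch_def Let_def)
  qed
  ultimately show "(legendre_Q \<nu> \<mu> \<longlongrightarrow> exp (\<i> * of_real pi * \<mu>) * exp (\<sigma> * \<i> * of_real pi * \<mu> / 2) * ferrers_branch (- \<sigma>) \<nu> \<mu> ?x)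
      (at ?x within ?S)"
    by (rule Lim_transform_eventually)
qed

section \<open>The Ferrers function as an average of two branches\<close>

text \<open>The phases in the definition are inverse to those of the two boundary values.\<close>

lemma ferrers_Q_interval_eq:
  assumes "-1 < x" "x < (1::real)"
  shows "ferrers_Q_interval \<nu> \<mu> (of_real x)
    = (ferrers_branch 1 \<nu> \<mu> (of_real x) + ferrers_branch (- 1) \<nu> \<mu> (of_real x)) / 2"
proof -
  let ?e = "\<i> * of_real pi * \<mu>"
  let ?L = "\<lambda>S. Lim (at (complex_of_real x) within S) (legendre_Q \<nu> \<mu>)"
  have cancel: "exp (- ?e / 2) * exp (- ?e) * (exp ?e * exp (?e / 2) * y) = y"
    "exp (?e / 2) * exp (- ?e) * (exp ?e * exp (- ?e / 2) * y) = y" for y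
    by (simp_all add: mult.assoc[symmetric] flip: exp_add)
  have upper: "?L {z. Im z > 0} = exp ?e * exp (?e / 2) * ferrers_branch (- 1) \<nu> \<mu> (of_real x)"
    using Lim_legendre_Q[OF assms, of 1] by simp
  have lower: "?L {z. Im z < 0} = exp ?e * exp (- ?e / 2) * ferrers_branch 1 \<nu> \<mu> (of_real x)"
    using Lim_legendre_Q[OF assms, of "- 1"] by simp
  have minus: "- \<i> * of_real pi * \<mu> = - ?e" by simp
  show ?thesis
    unfolding ferrers_Q_interval_def minus upper lower cancel by simp
qed

text \<open>The average is holomorphic on the connected set \<open>D1\<close> and has the prescribed
  values on the interval, which accumulates at 0.\<close>

lemma ferrers_Q_eq:
  assumes "x \<in> D1"
  shows "ferrers_Q \<nu> \<mu> x = (ferrers_branch 1 \<nu> \<mu> x + ferrers_branch (- 1) \<nu> \<mu> x) / 2"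
  unfolding ferrers_Q_def
proof (rule analytic_extension_eqI[OF open_D1 connected_D1, where \<xi> = 0])
  show "(\<lambda>x. (ferrers_branch 1 \<nu> \<mu> x + ferrers_branch (- 1) \<nu> \<mu> x) / 2) holomorphic_on D1"
    by (intro holomorphic_intros ferrers_branch_holomorphic) auto
  show "(0::complex) islimpt complex_of_real ` {-1<..<1}"
    unfolding islimpt_approachable
  proof (intro allI impI)
    fix e :: real assume "e > 0"
    then obtain d where d: "0 < d" "d < min e 1" using dense[of 0 "min e 1"] by auto
    then show "\<exists>y\<in>complex_of_real ` {-1<..<1}. y \<noteq> 0 \<and> dist y 0 < e"
      by (intro bexI[of _ "complex_of_real d"]) auto
  qed
  show "(ferrers_branch 1 \<nu> \<mu> w + ferrers_branch (- 1) \<nu> \<mu> w) / 2 = ferrers_Q_interval \<nu> \<mu> w"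
    if "w \<in> complex_of_real ` {-1<..<1}" for w
    using that ferrers_Q_interval_eq by auto
qed (use assms in \<open>auto simp: D1_eq\<close>)

theorem theorem6p1:
  fixes x \<nu> \<mu> u v :: complex
  assumes "x \<in> D1"
    and "\<nu> + \<mu> \<notin> neg_nats"
    and "u = x + \<i> * csqrt (1 - x\<^sup>2)"
    and "v = x - \<i> * csqrt (1 - x\<^sup>2)"
  shows "v = 1 / u \<and>
    ferrers_Q \<nu> \<mu> x =
      of_real (sqrt pi) * 2 powr (\<mu> - 1) * (1 - x\<^sup>2) powr (\<mu> / 2) * Gamma (\<nu> + \<mu> + 1)
      * (u powr (\<nu> + \<mu> + 1)
           * hyp2F1_over_Gamma (\<mu> + 1 / 2) (\<nu> + \<mu> + 1) (\<nu> + 3 / 2) (u / v)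
       + v powr (\<nu> + \<mu> + 1)
           * hyp2F1_over_Gamma (\<mu> + 1 / 2) (\<nu> + \<mu> + 1) (\<nu> + 3 / 2) (v / u))"
proof
  have "u * v = x\<^sup>2 + (csqrt (1 - x\<^sup>2))\<^sup>2"
    unfolding assms(3,4) power2_eq_square by (simp add: algebra_simps)
  then have uv: "u * v = 1" by simp
  then have "u \<noteq> 0" "v \<noteq> 0" by auto
  with uv show v: "v = 1 / u" by (simp add: field_simps)
  \<comment> \<open>As \<open>u\<close> and \<open>v\<close> are reciprocal, the quotients are the
    squares at which the branches evaluate the hypergeometric function.\<close>
  have "u / v = u\<^sup>2" "v / u = v\<^sup>2"
    using uv \<open>u \<noteq> 0\<close> \<open>v \<noteq> 0\<close> by (simp_all add: field_simps power2_eq_square)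
  moreover have "Im u \<noteq> 0" "Im v \<noteq> 0"
    using joukowski_branch[OF assms(1), of 1] joukowski_branch[OF assms(1), of "-1"]
    by (simp_all add: assms(3,4))
  then have "u\<^sup>2 \<in> slit_plane" "v\<^sup>2 \<in> slit_plane"
    using square_in_slit_plane by blast+
  \<comment> \<open>The factor 1/2 of the average turns \<open>2^\<mu>\<close> into
    \<open>2^(\<mu> - 1)\<close>.\<close>
  moreover have "(2 :: complex) powr \<mu> = 2 * 2 powr (\<mu> - 1)"
    by (simp add: powr_diff)
  ultimately show "ferrers_Q \<nu> \<mu> x =
      of_real (sqrt pi) * 2 powr (\<mu> - 1) * (1 - x\<^sup>2) powr (\<mu> / 2) * Gamma (\<nu> + \<mu> + 1)
      * (u powr (\<nu> + \<mu> + 1)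
           * hyp2F1_over_Gamma (\<mu> + 1 / 2) (\<nu> + \<mu> + 1) (\<nu> + 3 / 2) (u / v)
       + v powr (\<nu> + \<mu> + 1)
           * hyp2F1_over_Gamma (\<mu> + 1 / 2) (\<nu> + \<mu> + 1) (\<nu> + 3 / 2) (v / u))"
    by (simp add: ferrers_Q_eq[OF assms(1)] ferrers_branch_def hyp2F1_over_Gamma_eq_reg assms(3,4)[symmetric] algebra_simps)
qed

end
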